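(* Let $\mathcal{H}$ be a complex Hilbert space, $\mathcal{H}^{\infty}\subset\mathcal{H}$ a dense linear subspace, $\{d_j\}_{j\in\mathbb{N}_0}\subset\mathbb{N}$, and $\{e_j^k\}_{j\in\mathbb{N}_0,\,1\le k\le d_j}$ an orthonormal basis of $\mathcal{H}$ with $e_j^k\in\mathcal{H}^{\infty}$ for all $j,k$; let $H_j:=\mathrm{span}\{e_j^k\}_{k=1}^{d_j}$. An invariant (relative to $\{H_j\}_{j\in\mathbb{N}_0}$) linear operator $T:\mathcal{H}^{\infty}\to\mathcal{H}$ extends to a bounded operator from $\mathcal{H}$ to $\mathcal{H}$ if and only if its matrix symbol $\sigma$ satisfies $$\sup_{\ell\in\mathbb{N}_0}\|\sigma(\ell)\|_{\mathscr{L}(H_\ell)}<\infty.$$ Moreover, denoting this extension also by $T$, we have $$\|T\|_{\mathscr{L}(\mathcal{H})}=\sup_{\ell\in\mathbb{N}_0}\|\sigma(\ell)\|_{\mathscr{L}(H_\ell)}.$$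
   Context: $\mathbb{N}_0=\mathbb{N}\cup\{0\}$ with $\mathbb{N}=\{1,2,\dots\}$. For $f\in\mathcal{H}$, $\widehat f(j,k):=(f,e_j^k)_{\mathcal{H}}$, and $\widehat f(j)\in\mathbb{C}^{d_j}$ is the column vector with entries $\widehat f(j,k)$, $1\le k\le d_j$. A linear operator $T:\mathcal{H}^{\infty}\to\mathcal{H}$ is called invariant (or a Fourier multiplier) relative to $\{H_j\}_{j\in\mathbb{N}_0}$ if $T(H_j)\subset H_j$ for every $j$; equivalently, for each $\ell$ there is a matrix $\sigma(\ell)\in\mathbb{C}^{d_\ell\times d_\ell}$ such that $\widehat{Te_j^k}(\ell,m)=\sigma(\ell)_{mk}\delta_{j\ell}$ for all $j,k,m$, where $\delta_{j\ell}$ is the Kronecker delta. (If, in addition, all $e_j^k$ are in the domain of the adjoint $T^*$, this is also equivalent to $\widehat{Tf}(\ell)=\sigma(\ell)\widehat f(\ell)$ for all $f\in\mathcal{H}^{\infty}$ and all $\ell$, with the same matrices.) The family $\sigma=(\sigma(\ell))_{\ell\in\mathbb{N}_0}$ is the matrix symbol of $T$; explicitly $\sigma(j)_{mk}=(Te_j^k,e_j^m)_{\mathcal{H}}$. $\|\sigma(\ell)\|_{\mathscr{L}(H_\ell)}$ is the operator norm of the matrix $\sigma(\ell)$ acting on $H_\ell\simeq\mathbb{C}^{d_\ell}$ (Euclidean norm), via the basis $\{e_\ell^k\}_{k=1}^{d_\ell}$. $\mathscr{L}(\mathcal{H})$ is the space of bounded linear operators on $\mathcal{H}$ with the operator nor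m.
   Formalization: The "if" direction on H^∞ additionally assumes that all e_j^k lie in the domain of T* (without this it fails: T may vanish on the span of the e_j^k but not on H^∞); unconditionally, it is stated for T restricted to that span. "Only if" and the norm formula need no extra assumption. *)

theory Defs
  imports "HOL-Analysis.Analysis"
begin

section \<open>Complex Hilbert spaces\<close>

text \<open>
  HOL-Analysis only provides real inner product spaces.  A complex Hilbert space is a (real) Banach
  space with a compatible complex scalar multiplication and a complex inner product, linear in its
  first argument, that induces the norm.
\<close>

class complex_hilbert = banach +
  fixes scaleC :: "complex \<Rightarrow> 'a \<Rightarrow> 'a" (infixr \<open>*\<^sub>C\<close> 75)
    and cinner :: "'a \<Rightarrow> 'a \<Rightarrow> complex"
  assumes scaleC_add_right: "a *\<^sub>C (x + y) = a *\<^sub>C x + a *\<^sub>C y"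
    and scaleC_add_left: "(a + b) *\<^sub>C x = a *\<^sub>C x + b *\<^sub>C x"
    and scaleC_scaleC: "a *\<^sub>C b *\<^sub>C x = (a * b) *\<^sub>C x"
    and scaleC_of_real: "complex_of_real r *\<^sub>C x = r *\<^sub>R x"
    and cinner_add_left: "cinner (x + y) z = cinner x z + cinner y z"
    and cinner_scaleC_left: "cinner (a *\<^sub>C x) y = a * cinner x y"
    and cinner_commute: "cinner x y = cnj (cinner y x)"
    and cinner_nonneg: "0 \<le> Re (cinner x x)"
    and cinner_eq_zero_iff: "cinner x x = 0 \<longleftrightarrow> x = 0"
    and norm_eq_sqrt_cinner: "norm x = sqrt (Re (cinner x x))"

text \<open>Complex subspaces and spans: \<open>complex_vector.subspace\<close>, \<open>complex_vector.span\<close>.\<close>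

global_interpretation complex_vector:
  vector_space "scaleC :: complex \<Rightarrow> 'a \<Rightarrow> 'a::complex_hilbert"
proof
  fix a b :: complex and x y :: 'a
  show "a *\<^sub>C (x + y) = a *\<^sub>C x + a *\<^sub>C y" by (rule scaleC_add_right)
  show "(a + b) *\<^sub>C x = a *\<^sub>C x + b *\<^sub>C x" by (rule scaleC_add_left)
  show "a *\<^sub>C b *\<^sub>C x = (a * b) *\<^sub>C x" by (rule scaleC_scaleC)
  show "1 *\<^sub>C x = x" using scaleC_of_real[of 1 x] by simp
qed

text \<open>
  A partially defined operator with domain \<open>D\<close> is represented by a total function whose values
  outside \<open>D\<close> are irrelevant.
\<close>

definition clinear_on :: "'a::complex_hilbert set \<Rightarrow> ('a \<Rightarrow> 'a) \<Rightarrow> bool" where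
  "clinear_on D T \<longleftrightarrow>
     (\<forall>x\<in>D. \<forall>y\<in>D. T (x + y) = T x + T y) \<and> (\<forall>c. \<forall>x\<in>D. T (c *\<^sub>C x) = c *\<^sub>C T x)"

text \<open>The elements of \<open>\<L>(\<H>)\<close>; their operator norm is \<open>onorm\<close>.\<close>

definition bounded_clinear :: "('a::complex_hilbert \<Rightarrow> 'a) \<Rightarrow> bool" where
  "bounded_clinear S \<longleftrightarrow> bounded_linear S \<and> (\<forall>c x. S (c *\<^sub>C x) = c *\<^sub>C S x)"

definition bounded_extension ::
  "'a::complex_hilbert set \<Rightarrow> ('a \<Rightarrow> 'a) \<Rightarrow> ('a \<Rightarrow> 'a) \<Rightarrow> bool" where
  "bounded_extension D T S \<longleftrightarrow> bounded_clinear S \<and> (\<forall>x\<in>D. S x = T x)"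

text \<open>
  The domain of \<open>T\<^sup>*\<close>.  Invariance does not constrain \<open>T\<close> outside the algebraic span of the basis, so
  bounded symbols alone do not make \<open>T\<close> bounded on a larger domain \<open>D\<close>: \<open>T\<close> may vanish on that span
  and be nonzero at some \<open>v \<in> D\<close>.  This is excluded if the basis vectors lie in the domain of \<open>T\<^sup>*\<close>,
  which holds whenever \<open>T\<close> has a bounded extension.
\<close>

definition adjoint_domain :: "'a::complex_hilbert set \<Rightarrow> ('a \<Rightarrow> 'a) \<Rightarrow> 'a set" where
  "adjoint_domain D T = {g. \<exists>h. \<forall>f\<in>D. cinner (T f) g = cinner f h}"


section \<open>Fourier multipliers\<close>

text \<open>
  Families \<open>e\<close> are indexed by \<open>j :: nat\<close> and \<open>k \<in> {1..d j}\<close>; \<open>e j k\<close> is irrelevant for other \<open>k\<close>.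
\<close>

definition basis_vectors :: "(nat \<Rightarrow> nat) \<Rightarrow> (nat \<Rightarrow> nat \<Rightarrow> 'a) \<Rightarrow> 'a set" where
  "basis_vectors d e = {e j k | j k. k \<in> {1..d j}}"

definition orthonormal_basis ::
  "(nat \<Rightarrow> nat) \<Rightarrow> (nat \<Rightarrow> nat \<Rightarrow> 'a::complex_hilbert) \<Rightarrow> bool" where
  "orthonormal_basis d e \<longleftrightarrow>
     (\<forall>i j. \<forall>k\<in>{1..d i}. \<forall>m\<in>{1..d j}.
        cinner (e i k) (e j m) = (if i = j \<and> k = m then 1 else 0)) \<and>
     closure (complex_vector.span (basis_vectors d e)) = UNIV"

definition component_space ::
  "(nat \<Rightarrow> nat) \<Rightarrow> (nat \<Rightarrow> nat \<Rightarrow> 'a::complex_hilbert) \<Rightarrow> nat \<Rightarrow> 'a set" where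
  "component_space d e j = complex_vector.span (e j ` {1..d j})"

definition invariant_operator ::
  "(nat \<Rightarrow> nat) \<Rightarrow> (nat \<Rightarrow> nat \<Rightarrow> 'a::complex_hilbert) \<Rightarrow> ('a \<Rightarrow> 'a) \<Rightarrow> bool" where
  "invariant_operator d e T \<longleftrightarrow> (\<forall>j. T ` component_space d e j \<subseteq> component_space d e j)"

text \<open>
  The entry in row \<open>m\<close>, column \<open>k\<close> of \<open>\<sigma>(j)\<close> is \<open>symbol e T j m k\<close>, for \<open>m, k \<in> {1..d j}\<close>.
\<close>

definition symbol ::
  "(nat \<Rightarrow> nat \<Rightarrow> 'a::complex_hilbert) \<Rightarrow> ('a \<Rightarrow> 'a) \<Rightarrow> nat \<Rightarrow> nat \<Rightarrow> nat \<Rightarrow> complex" where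
  "symbol e T j m k = cinner (T (e j k)) (e j m)"

text \<open>
  Since the matrix size varies with \<open>j\<close>, an \<open>n \<times> n\<close> matrix is a function restricted to indices in
  \<open>{1..n}\<close>, and likewise for vectors.
\<close>

definition cvec_norm :: "nat \<Rightarrow> (nat \<Rightarrow> complex) \<Rightarrow> real" where
  "cvec_norm n v = L2_set (\<lambda>k. cmod (v k)) {1..n}"

definition matrix_opnorm :: "nat \<Rightarrow> (nat \<Rightarrow> nat \<Rightarrow> complex) \<Rightarrow> real" where
  "matrix_opnorm n A =
     (SUP v\<in>{v. cvec_norm n v \<le> 1}. cvec_norm n (\<lambda>m. \<Sum>k=1..n. A m k * v k))"

definition symbol_norm ::
  "(nat \<Rightarrow> nat) \<Rightarrow> (nat \<Rightarrow> nat \<Rightarrow> 'a::complex_hilbert) \<Rightarrow> ('a \<Rightarrow> 'a) \<Rightarrow> nat \<Rightarrow> real" where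
  "symbol_norm d e T l = matrix_opnorm (d l) (symbol e T l)"

end

theory Submission
  imports Defs
begin

text \<open>
  In the orthonormal basis an invariant operator is block diagonal: on the finite sums of basis
  vectors it acts on the \<open>j\<close>-th block of coordinates by the matrix \<open>\<sigma>(j)\<close> (\<open>operator_block\<close>).  The
  blocks are mutually orthogonal, so the Pythagorean identity (\<open>norm_sum_block\<close>) adds up the
  estimates in the individual blocks without loss: a common bound for the matrix norms is a bound
  for \<open>T\<close> on the algebraic span of the basis, with the same constant (\<open>norm_operator_le\<close>).
  Conversely, testing a bounded extension on the vectors of a single block shows that its norm
  dominates every \<open>\<parallel>\<sigma>(j)\<parallel>\<close> (\<open>symbol_norm_le_onorm\<close>).  As the span is dense, a
  bounded operator on it extends to the whole space by uniform continuity, which gives the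
  equivalence and the norm formula for the span.

  On a larger domain there remains the question whether the extension \<open>S\<close> of the restriction to the
  span agrees with \<open>T\<close>.  If \<open>T f\<close> paired with a basis vector \<open>g\<close> equals \<open>f\<close> paired with a fixed
  vector, then this pairing is continuous in \<open>f\<close>, and so is that of \<open>S f\<close> with \<open>g\<close>; the two agree
  on the dense span, hence on the whole domain, and \<open>S f - T f\<close> vanishes because it is orthogonal
  to every basis vector (\<open>extension_agrees_on_domain\<close>).
\<close>

section \<open>The complex inner product\<close>

lemma cinner_zero_left [simp]: "cinner 0 (y :: 'a::complex_hilbert) = 0"
  using cinner_add_left[of 0 0 y] by simp

lemma cinner_zero_right [simp]: "cinner (x :: 'a::complex_hilbert) 0 = 0"
  using cinner_commute[of x 0] by simp

lemma cinner_add_right: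
  "cinner (x :: 'a::complex_hilbert) (y + z) = cinner x y + cinner x z"
  by (metis cinner_add_left cinner_commute complex_cnj_add)

lemma cinner_scaleC_right: "cinner (x :: 'a::complex_hilbert) (a *\<^sub>C y) = cnj a * cinner x y"
  by (metis cinner_scaleC_left cinner_commute complex_cnj_mult)

lemma cinner_diff_left: "cinner (x - y) (z :: 'a::complex_hilbert) = cinner x z - cinner y z"
  using cinner_add_left[of "x - y" y z] by simp

lemma cinner_diff_right: "cinner (x :: 'a::complex_hilbert) (y - z) = cinner x y - cinner x z"
  using cinner_add_right[of x "y - z" z] by simp

lemma cinner_sum_left: "cinner (\<Sum>i\<in>A. f i) (y :: 'a::complex_hilbert) = (\<Sum>i\<in>A. cinner (f i) y)"
  by (induction A rule: infinite_finite_induct) (auto simp: cinner_add_left)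

lemma cinner_sum_right: "cinner (x :: 'a::complex_hilbert) (\<Sum>i\<in>A. f i) = (\<Sum>i\<in>A. cinner x (f i))"
  by (induction A rule: infinite_finite_induct) (auto simp: cinner_add_right)

lemma power2_norm_eq_cinner: "(norm (x :: 'a::complex_hilbert))\<^sup>2 = Re (cinner x x)"
  by (simp add: norm_eq_sqrt_cinner cinner_nonneg)

lemma norm_scaleC [simp]: "norm (c *\<^sub>C (x :: 'a::complex_hilbert)) = cmod c * norm x"
proof -
  have "cinner (c *\<^sub>C x) (c *\<^sub>C x) = of_real ((cmod c)\<^sup>2) * cinner x x"
    by (simp add: cinner_scaleC_left cinner_scaleC_right complex_norm_square mult_ac del: of_real_power)
  then show ?thesis
    by (simp add: norm_eq_sqrt_cinner real_sqrt_mult)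
qed

lemma continuous_on_scaleC: "continuous_on A (\<lambda>x :: 'a::complex_hilbert. c *\<^sub>C x)"
proof -
  have "bounded_linear (\<lambda>x :: 'a. c *\<^sub>C x)"
    by (rule bounded_linear_intro[where K = "cmod c"])
      (auto simp: scaleC_add_right mult_ac scaleC_scaleC simp flip: scaleC_of_real)
  then show ?thesis
    by (rule linear_continuous_on)
qed

text \<open>
  Polarization writes the real part of the inner product in terms of norms; since the imaginary
  part of \<open>cinner x y\<close> is the real part of \<open>cinner x (\<i> *\<^sub>C y)\<close>, continuity of the norm suffices.
\<close>

lemma continuous_on_cinner_left: "continuous_on A (\<lambda>x :: 'a::complex_hilbert. cinner x y)"
proof -
  have polarization: "Re (cinner x z) = ((norm (x + z))\<^sup>2 - (norm (x - z))\<^sup>2) / 4" for x z :: 'a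
    using arg_cong[OF cinner_commute[of x z], of Re]
    by (simp add: power2_norm_eq_cinner cinner_add_left cinner_add_right cinner_diff_left
        cinner_diff_right)
  have eq: "(\<lambda>x. cinner x y) = (\<lambda>x. Complex (Re (cinner x y)) (Re (cinner x (\<i> *\<^sub>C y))))"
    by (simp add: cinner_scaleC_right complex_eq_iff)
  show ?thesis
    by (subst eq, unfold polarization Complex_eq, intro continuous_intros) auto
qed

lemma orthogonal_to_span:
  fixes x :: "'a::complex_hilbert"
  assumes "\<And>b. b \<in> B \<Longrightarrow> cinner x b = 0" and "y \<in> complex_vector.span B"
  shows "cinner x y = 0"
  using assms(2)
  by (induction rule: complex_vector.span_induct_alt)
    (simp_all add: assms(1) cinner_add_right cinner_scaleC_right)

lemma orthogonal_to_dense_span: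
  fixes x :: "'a::complex_hilbert"
  assumes "\<And>b. b \<in> B \<Longrightarrow> cinner x b = 0" and "closure (complex_vector.span B) = UNIV"
  shows "x = 0"
proof -
  have "cinner y x = 0" if "y \<in> complex_vector.span B" for y
    using orthogonal_to_span[OF assms(1) that] cinner_commute[of y x] by simp
  then have "cinner x x = 0"
    using continuous_constant_on_closure[where S = "complex_vector.span B" and f = "\<lambda>y. cinner y x" and a = 0 and x = x]
    by (simp add: assms(2) continuous_on_cinner_left)
  then show ?thesis
    by (simp add: cinner_eq_zero_iff)
qed


section \<open>Extension of bounded operators from dense subspaces\<close>

lemma clinear_on_zero:
  assumes "clinear_on V T" and "complex_vector.subspace V"
  shows "T 0 = 0"
  using assms by (metis clinear_on_def complex_vector.scale_zero_left complex_vector.subspace_0)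

lemma clinear_on_sum:
  assumes "clinear_on V T" and "complex_vector.subspace V" and "\<And>i. i \<in> A \<Longrightarrow> f i \<in> V"
  shows "T (\<Sum>i\<in>A. f i) = (\<Sum>i\<in>A. T (f i))"
  using assms(3)
proof (induction A rule: infinite_finite_induct)
  case (insert i A)
  then have "(\<Sum>i\<in>A. f i) \<in> V"
    by (intro complex_vector.subspace_sum[OF assms(2)]) auto
  with insert assms(1) show ?case
    by (simp add: clinear_on_def)
qed (simp_all add: clinear_on_zero[OF assms(1,2)])

lemma clinear_on_diff:
  assumes "clinear_on V T" and "complex_vector.subspace V" and "x \<in> V" and "y \<in> V"
  shows "T (x - y) = T x - T y"
proof -
  have "T (x - y) + T y = T ((x - y) + y)"
    using assms complex_vector.subspace_diff[OF assms(2-4)] unfolding clinear_on_def by metis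
  then show ?thesis
    by (simp add: algebra_simps)
qed

lemma continuous_eq_on_dense:
  fixes f g :: "'a::topological_space \<Rightarrow> 'b::real_normed_vector"
  assumes "continuous_on UNIV f" and "continuous_on UNIV g" and "closure V = UNIV"
    and "\<And>x. x \<in> V \<Longrightarrow> f x = g x"
  shows "f = g"
proof
  fix x
  have "f x - g x = 0"
    by (rule continuous_constant_on_closure[where S = V and f = "\<lambda>x. f x - g x"])
      (use assms in \<open>auto intro: continuous_on_diff\<close>)
  then show "f x = g x"
    by simp
qed

lemma bound_on_dense_set:
  fixes S :: "'a::real_normed_vector \<Rightarrow> 'b::real_normed_vector"
  assumes "continuous_on UNIV S" and "closure V = UNIV"
    and "\<And>x. x \<in> V \<Longrightarrow> norm (S x) \<le> M * norm x"
  shows "norm (S x) \<le> M * norm x"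
proof -
  have "norm (S x) - M * norm x \<le> 0"
    by (rule continuous_le_on_closure[where S = V])
      (use assms in \<open>auto intro!: continuous_intros\<close>)
  then show ?thesis
    by simp
qed

text \<open>
  A bounded operator is Lipschitz, hence extends to the closure of its domain by uniform continuity;
  the algebraic identities and the bound persist because both sides are continuous.
\<close>

lemma bounded_extension_of_dense:
  fixes T :: "'a::complex_hilbert \<Rightarrow> 'a"
  assumes lin: "clinear_on V T" and V: "complex_vector.subspace V" and dense: "closure V = UNIV"
    and bound: "\<And>x. x \<in> V \<Longrightarrow> norm (T x) \<le> M * norm x"
  shows "\<exists>S. bounded_extension V T S"
proof -
  have "(max M 0)-lipschitz_on V T"
  proof (rule lipschitz_onI)
    fix x y assume xy: "x \<in> V" "y \<in> V"
    have "norm (T x - T y) \<le> M * norm (x - y)"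
      using bound[OF complex_vector.subspace_diff[OF V xy]] clinear_on_diff[OF lin V xy] by simp
    also have "\<dots> \<le> max M 0 * norm (x - y)"
      by (intro mult_right_mono) auto
    finally show "dist (T x) (T y) \<le> max M 0 * dist x y"
      by (simp add: dist_norm)
  qed simp
  then have "uniformly_continuous_on V T"
    by (rule lipschitz_on_uniformly_continuous)
  then obtain S where S: "uniformly_continuous_on (closure V) S" "\<And>x. x \<in> V \<Longrightarrow> T x = S x"
    by (rule uniformly_continuous_on_extension_on_closure) blast
  have cont: "continuous_on UNIV S"
    using uniformly_continuous_imp_continuous[OF S(1)] by (simp add: dense)
  have cont': "continuous_on A (\<lambda>x. S (f x))" if "continuous_on A f" for f :: "'b::topological_space \<Rightarrow> 'a" and A
    by (rule continuous_on_compose2[OF cont that]) simp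
  have "(\<lambda>p. S (fst p + snd p)) = (\<lambda>p. S (fst p) + S (snd p))"
  proof (rule continuous_eq_on_dense[where V = "V \<times> V"])
    show "S (fst p + snd p) = S (fst p) + S (snd p)" if "p \<in> V \<times> V" for p
      using that lin complex_vector.subspace_add[OF V, of "fst p" "snd p"]
      by (auto simp: clinear_on_def simp flip: S(2))
  qed (auto intro!: continuous_intros cont' simp: closure_Times dense)
  then have add: "S (x + y) = S x + S y" for x y
    by (metis fst_conv snd_conv)
  have "(\<lambda>x. S (c *\<^sub>C x)) = (\<lambda>x. c *\<^sub>C S x)" for c
  proof (rule continuous_eq_on_dense[OF _ _ dense])
    show "continuous_on UNIV (\<lambda>x. c *\<^sub>C S x)"
      by (rule continuous_on_compose2[OF continuous_on_scaleC[of UNIV] cont]) simp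
    show "S (c *\<^sub>C x) = c *\<^sub>C S x" if "x \<in> V" for x
      using that lin complex_vector.subspace_scale[OF V that, of c]
      by (auto simp: clinear_on_def simp flip: S(2))
  qed (intro cont' continuous_on_scaleC)
  then have scale: "S (c *\<^sub>C x) = c *\<^sub>C S x" for c x
    by metis
  have "norm (S x) \<le> M * norm x" for x
    by (rule bound_on_dense_set[OF cont dense]) (simp add: bound flip: S(2))
  then have "bounded_linear S"
    by (intro bounded_linear_intro[where K = M])
      (simp_all add: add scale mult.commute flip: scaleC_of_real)
  with scale S(2) show ?thesis
    by (auto simp: bounded_extension_def bounded_clinear_def)
qed

text \<open>
  Membership of \<open>B\<close> in the domain of the adjoint makes the pairings of \<open>T f\<close> with the elements
  of \<open>B\<close> continuous in \<open>f\<close> even before \<open>T\<close> is known to be continuous on \<open>D\<close>.  This is what carries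
  the agreement of \<open>S\<close> and \<open>T\<close> from the span over to \<open>D\<close>.
\<close>

lemma extension_agrees_on_domain:
  fixes S T :: "'a::complex_hilbert \<Rightarrow> 'a"
  assumes ext: "bounded_extension (complex_vector.span B) T S"
    and dense: "closure (complex_vector.span B) = UNIV"
    and sub: "complex_vector.span B \<subseteq> D" and adj: "B \<subseteq> adjoint_domain D T"
  shows "bounded_extension D T S"
proof -
  have "bounded_linear S"
    using ext by (simp add: bounded_extension_def bounded_clinear_def)
  then have cont: "continuous_on A S" for A
    by (rule linear_continuous_on)
  have "S f = T f" if f: "f \<in> D" for f
  proof -
    have "cinner (S f - T f) g = 0" if "g \<in> B" for g
    proof -
      obtain h where h: "\<And>f. f \<in> D \<Longrightarrow> cinner (T f) g = cinner f h"
        using adj \<open>g \<in> B\<close> by (auto simp: adjoint_domain_def)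
      have "(\<lambda>f. cinner (S f) g) = (\<lambda>f. cinner f h)"
      proof (rule continuous_eq_on_dense[OF _ _ dense])
        show "continuous_on UNIV (\<lambda>f. cinner (S f) g)"
          by (rule continuous_on_compose2[OF continuous_on_cinner_left[of UNIV] cont]) simp
        show "cinner (S f) g = cinner f h" if "f \<in> complex_vector.span B" for f
          using that ext sub h by (auto simp: bounded_extension_def)
      qed (rule continuous_on_cinner_left)
      then have "cinner (S f) g = cinner f h"
        by metis
      with h[OF f] show ?thesis
        by (simp add: cinner_diff_left)
    qed
    then show ?thesis
      using orthogonal_to_dense_span[OF _ dense, of "S f - T f"] by simp
  qed
  with ext show ?thesis
    by (simp add: bounded_extension_def)
qed


section \<open>Matrix norms\<close>

lemma cvec_norm_nonneg [simp]: "0 \<le> cvec_norm n v"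
  by (simp add: cvec_norm_def)

lemma cvec_norm_cmult: "cvec_norm n (\<lambda>k. c * v k) = cmod c * cvec_norm n v"
  by (simp add: cvec_norm_def norm_mult L2_set_right_distrib)

text \<open>
  The supremum defining \<open>matrix_opnorm\<close> is taken in the reals, so it is meaningful only once the
  set is known to be bounded.
\<close>

lemma bdd_above_matrix_image:
  "bdd_above ((\<lambda>v. cvec_norm n (\<lambda>m. \<Sum>k=1..n. A m k * v k)) ` {v. cvec_norm n v \<le> 1})"
proof (rule bdd_aboveI2)
  fix v assume "v \<in> {v. cvec_norm n v \<le> 1}"
  then have v: "cmod (v k) \<le> 1" if "k \<in> {1..n}" for k
    using member_le_L2_set[of "{1..n}" k "\<lambda>k. cmod (v k)"] that by (simp add: cvec_norm_def)
  have "cvec_norm n (\<lambda>m. \<Sum>k=1..n. A m k * v k) \<le> (\<Sum>m=1..n. cmod (\<Sum>k=1..n. A m k * v k))"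
    unfolding cvec_norm_def by (rule L2_set_le_sum) simp
  also have "\<dots> \<le> (\<Sum>m=1..n. \<Sum>k=1..n. cmod (A m k))"
    using v by (intro sum_mono sum_norm_le) (auto simp: norm_mult intro: mult_left_le)
  finally show "cvec_norm n (\<lambda>m. \<Sum>k=1..n. A m k * v k) \<le> (\<Sum>m=1..n. \<Sum>k=1..n. cmod (A m k))" .
qed

lemma matrix_opnorm_nonneg: "0 \<le> matrix_opnorm n A"
  unfolding matrix_opnorm_def
  by (rule cSUP_upper2[OF bdd_above_matrix_image, where x = "\<lambda>_. 0"])
    (simp_all add: cvec_norm_def L2_set_def)

lemma symbol_norm_nonneg: "0 \<le> symbol_norm d e T l"
  unfolding symbol_norm_def by (rule matrix_opnorm_nonneg)

lemma cvec_norm_matrix_le: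
  "cvec_norm n (\<lambda>m. \<Sum>k=1..n. A m k * v k) \<le> matrix_opnorm n A * cvec_norm n v"
proof (cases "cvec_norm n v = 0")
  case True
  then have "v k = 0" if "k \<in> {1..n}" for k
    using that by (simp add: cvec_norm_def L2_set_eq_0_iff)
  with True show ?thesis
    by (simp add: cvec_norm_def L2_set_def)
next
  case False
  define r where "r = cvec_norm n v"
  have r: "r > 0"
    using False cvec_norm_nonneg[of n v] by (simp add: r_def less_le)
  let ?u = "\<lambda>k. of_real (1 / r) * v k"
  have u: "cvec_norm n ?u \<le> 1"
    using r by (subst cvec_norm_cmult) (simp add: norm_divide flip: r_def)
  have "(\<lambda>m. \<Sum>k=1..n. A m k * ?u k) = (\<lambda>m. of_real (1 / r) * (\<Sum>k=1..n. A m k * v k))"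
    by (simp add: sum_distrib_left mult_ac)
  then have "cvec_norm n (\<lambda>m. \<Sum>k=1..n. A m k * v k) / r = cvec_norm n (\<lambda>m. \<Sum>k=1..n. A m k * ?u k)"
    using r by (simp only: cvec_norm_cmult) (simp add: norm_divide)
  also have "\<dots> \<le> matrix_opnorm n A"
    unfolding matrix_opnorm_def using u by (intro cSUP_upper bdd_above_matrix_image) simp
  finally show ?thesis
    using r by (simp add: r_def field_simps)
qed

lemma matrix_opnorm_least:
  assumes "\<And>v. cvec_norm n v \<le> 1 \<Longrightarrow> cvec_norm n (\<lambda>m. \<Sum>k=1..n. A m k * v k) \<le> M"
  shows "matrix_opnorm n A \<le> M"
proof -
  have "(\<lambda>_. 0) \<in> {v. cvec_norm n v \<le> 1}"
    by (simp add: cvec_norm_def L2_set_def)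
  then show ?thesis
    unfolding matrix_opnorm_def using assms by (intro cSUP_least) auto
qed


section \<open>Block decomposition along an orthonormal basis\<close>

definition block_vector :: "(nat \<Rightarrow> nat) \<Rightarrow> (nat \<Rightarrow> nat \<Rightarrow> 'a::complex_hilbert) \<Rightarrow> nat \<Rightarrow> (nat \<Rightarrow> complex) \<Rightarrow> 'a"
  where "block_vector d e j c = (\<Sum>k=1..d j. c k *\<^sub>C e j k)"

lemma block_vector_add:
  "block_vector d e j (\<lambda>k. b k + c k) = block_vector d e j b + block_vector d e j c"
  by (simp add: block_vector_def scaleC_add_left sum.distrib)

lemma block_vector_scaleC: "block_vector d e j (\<lambda>k. a * c k) = a *\<^sub>C block_vector d e j c"
  by (simp add: block_vector_def complex_vector.scale_sum_right)

lemma block_vector_0: "block_vector d e j (\<lambda>k. 0) = 0"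
  by (simp add: block_vector_def)

lemma basis_vectorsI: "k \<in> {1..d j} \<Longrightarrow> e j k \<in> basis_vectors d e"
  by (auto simp: basis_vectors_def)

lemma block_vector_in_span: "block_vector d e j c \<in> complex_vector.span (basis_vectors d e)"
  unfolding block_vector_def
  by (intro complex_vector.span_sum complex_vector.span_scale complex_vector.span_base basis_vectorsI)

context
  fixes d :: "nat \<Rightarrow> nat" and e :: "nat \<Rightarrow> nat \<Rightarrow> 'a::complex_hilbert"
  assumes onb: "orthonormal_basis d e"
begin

lemma cinner_basis:
  "k \<in> {1..d i} \<Longrightarrow> m \<in> {1..d j} \<Longrightarrow> cinner (e i k) (e j m) = (if i = j \<and> k = m then 1 else 0)"
  using onb by (simp add: orthonormal_basis_def)

lemma dense_span_basis: "closure (complex_vector.span (basis_vectors d e)) = UNIV"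
  using onb by (simp add: orthonormal_basis_def)

lemma block_vector_basis_coefficients:
  assumes "k \<in> {1..d i}"
  shows "block_vector d e j (\<lambda>m. cinner (e i k) (e j m)) = (if i = j then e i k else 0)"
proof -
  have "block_vector d e j (\<lambda>m. cinner (e i k) (e j m))
      = (\<Sum>m=1..d j. if i = j \<and> k = m then e j m else 0)"
    unfolding block_vector_def using assms by (intro sum.cong) (auto simp: cinner_basis)
  with assms show ?thesis
    by auto
qed

lemma cinner_block_basis:
  assumes "m \<in> {1..d j}"
  shows "cinner (block_vector d e i c) (e j m) = (if i = j then c m else 0)"
proof -
  have "cinner (block_vector d e i c) (e j m) = (\<Sum>k=1..d i. if i = j \<and> k = m then c k else 0)"
    unfolding block_vector_def cinner_sum_left cinner_scaleC_left
    using assms by (intro sum.cong) (auto simp: cinner_basis)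
  with assms show ?thesis
    by auto
qed

lemma cinner_block_block:
  "cinner (block_vector d e i b) (block_vector d e j c)
    = (if i = j then \<Sum>k=1..d j. b k * cnj (c k) else 0)"
proof -
  have "cinner (block_vector d e i b) (block_vector d e j c)
      = (\<Sum>k=1..d j. cnj (c k) * cinner (block_vector d e i b) (e j k))"
    unfolding block_vector_def[of d e j c] cinner_sum_right cinner_scaleC_right ..
  also have "\<dots> = (\<Sum>k=1..d j. cnj (c k) * (if i = j then b k else 0))"
    by (intro sum.cong) (simp_all add: cinner_block_basis)
  finally show ?thesis
    by (simp add: mult.commute)
qed

lemma norm_block: "norm (block_vector d e j c) = cvec_norm (d j) c"
  by (simp add: norm_eq_sqrt_cinner cinner_block_block cvec_norm_def L2_set_def
      flip: complex_norm_square)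

lemma norm_sum_block:
  "(norm (\<Sum>j<n. block_vector d e j (c j)))\<^sup>2 = (\<Sum>j<n. (cvec_norm (d j) (c j))\<^sup>2)"
proof -
  have "cinner (\<Sum>i<n. block_vector d e i (c i)) (\<Sum>j<n. block_vector d e j (c j))
      = (\<Sum>j<n. cinner (block_vector d e j (c j)) (block_vector d e j (c j)))"
    unfolding cinner_sum_left cinner_sum_right by (intro sum.cong) (simp_all add: cinner_block_block)
  then show ?thesis
    by (simp add: power2_norm_eq_cinner flip: norm_block)
qed

lemma component_space_expansion:
  assumes "x \<in> component_space d e j"
  shows "x = block_vector d e j (\<lambda>k. cinner x (e j k))"
  using assms unfolding component_space_def
proof (induction rule: complex_vector.span_induct_alt)
  case base
  then show ?case by (simp add: block_vector_0)
next
  case (step a x y)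
  then obtain k where k: "k \<in> {1..d j}" "x = e j k"
    by auto
  then have "block_vector d e j (\<lambda>m. cinner x (e j m)) = x"
    by (simp add: block_vector_basis_coefficients)
  with step show ?case
    by (simp add: cinner_add_left cinner_scaleC_left block_vector_add block_vector_scaleC)
qed

text \<open>
  Asking for all sufficiently late partial sums of the Fourier expansion to recover \<open>x\<close>, rather than
  for one of them, makes the property visibly stable under linear combinations.
\<close>

lemma eventually_fourier_expansion:
  assumes "x \<in> complex_vector.span (basis_vectors d e)"
  shows "\<forall>\<^sub>F n in sequentially. x = (\<Sum>j<n. block_vector d e j (\<lambda>k. cinner x (e j k)))"
  using assms
proof (induction rule: complex_vector.span_induct_alt)
  case base
  then show ?case by (simp add: block_vector_0)
next
  case (step a x y)
  then obtain i k where ik: "k \<in> {1..d i}" "x = e i k"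
    by (auto simp: basis_vectors_def)
  then have block: "block_vector d e j (\<lambda>m. cinner x (e j m)) = (if i = j then x else 0)" for j
    by (simp add: block_vector_basis_coefficients)
  show ?case
    using step(2) eventually_gt_at_top[of i]
  proof eventually_elim
    case (elim n)
    then show ?case
      by (simp add: cinner_add_left cinner_scaleC_left block_vector_add block_vector_scaleC
          sum.distrib block flip: complex_vector.scale_sum_right)
  qed
qed

lemma span_basis_expansion:
  assumes "x \<in> complex_vector.span (basis_vectors d e)"
  obtains n where "x = (\<Sum>j<n. block_vector d e j (\<lambda>k. cinner x (e j k)))"
  using eventually_fourier_expansion[OF assms] by (auto simp: eventually_sequentially)


section \<open>Invariant operators\<close>

context
  fixes T :: "'a \<Rightarrow> 'a"
  assumes lin: "clinear_on (complex_vector.span (basis_vectors d e)) T"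
    and inv: "invariant_operator d e T"
begin

lemma operator_basis:
  assumes "k \<in> {1..d j}"
  shows "T (e j k) = block_vector d e j (\<lambda>m. symbol e T j m k)"
proof -
  have "e j k \<in> component_space d e j"
    unfolding component_space_def using assms by (intro complex_vector.span_base) auto
  then have "T (e j k) \<in> component_space d e j"
    using inv by (auto simp: invariant_operator_def)
  from component_space_expansion[OF this] show ?thesis
    by (simp add: symbol_def)
qed

lemma operator_block:
  "T (block_vector d e j c) = block_vector d e j (\<lambda>m. \<Sum>k=1..d j. symbol e T j m k * c k)"
proof -
  have basis: "e j k \<in> complex_vector.span (basis_vectors d e)" if "k \<in> {1..d j}" for k
    using that by (intro complex_vector.span_base basis_vectorsI)
  have "T (block_vector d e j c) = (\<Sum>k=1..d j. T (c k *\<^sub>C e j k))"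
    unfolding block_vector_def
    by (intro clinear_on_sum[OF lin] complex_vector.subspace_span complex_vector.span_scale
        basis)
  also have "\<dots> = (\<Sum>k=1..d j. c k *\<^sub>C T (e j k))"
    using lin basis by (intro sum.cong) (simp_all add: clinear_on_def)
  also have "\<dots> = (\<Sum>k=1..d j. \<Sum>m=1..d j. (symbol e T j m k * c k) *\<^sub>C e j m)"
    by (intro sum.cong)
      (simp_all add: operator_basis block_vector_def complex_vector.scale_sum_right mult.commute)
  also have "\<dots> = block_vector d e j (\<lambda>m. \<Sum>k=1..d j. symbol e T j m k * c k)"
    unfolding block_vector_def complex_vector.scale_sum_left by (rule sum.swap)
  finally show ?thesis .
qed

text \<open>
  No cross terms arise in the norm of \<open>T x\<close>, because the images of different blocks stay orthogonal;
  this is why the bound on the whole span is no worse than the bound in the single blocks.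
\<close>

lemma norm_operator_le:
  assumes M: "\<And>l. symbol_norm d e T l \<le> M" and x: "x \<in> complex_vector.span (basis_vectors d e)"
  shows "norm (T x) \<le> M * norm x"
proof -
  have "M \<ge> 0"
    using symbol_norm_nonneg M by (rule order_trans)
  define c where "c = (\<lambda>j k. cinner x (e j k))"
  define Tc where "Tc = (\<lambda>j m. \<Sum>k=1..d j. symbol e T j m k * c j k)"
  obtain n where n: "x = (\<Sum>j<n. block_vector d e j (c j))"
    using span_basis_expansion[OF x] unfolding c_def .
  have Tx: "T x = (\<Sum>j<n. block_vector d e j (Tc j))"
    unfolding n Tc_def
    by (simp add: clinear_on_sum[OF lin complex_vector.subspace_span] block_vector_in_span operator_block)
  have "cvec_norm (d j) (Tc j) \<le> M * cvec_norm (d j) (c j)" for j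
  proof -
    have "cvec_norm (d j) (Tc j) \<le> symbol_norm d e T j * cvec_norm (d j) (c j)"
      unfolding Tc_def symbol_norm_def by (rule cvec_norm_matrix_le)
    also have "\<dots> \<le> M * cvec_norm (d j) (c j)"
      by (intro mult_right_mono M) simp
    finally show ?thesis .
  qed
  then have "(\<Sum>j<n. (cvec_norm (d j) (Tc j))\<^sup>2) \<le> (\<Sum>j<n. (M * cvec_norm (d j) (c j))\<^sup>2)"
    by (intro sum_mono power_mono) auto
  then have "(norm (T x))\<^sup>2 \<le> M\<^sup>2 * (\<Sum>j<n. (cvec_norm (d j) (c j))\<^sup>2)"
    unfolding Tx norm_sum_block by (simp add: power_mult_distrib sum_distrib_left)
  also have "\<dots> = (M * norm x)\<^sup>2"
    unfolding power_mult_distrib n norm_sum_block ..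
  finally show ?thesis
    by (rule power2_le_imp_le) (simp add: \<open>M \<ge> 0\<close>)
qed

context
  fixes S :: "'a \<Rightarrow> 'a"
  assumes ext: "bounded_extension (complex_vector.span (basis_vectors d e)) T S"
begin

lemma bounded_linear_extension: "bounded_linear S"
  using ext by (simp add: bounded_extension_def bounded_clinear_def)

lemma extension_eq: "x \<in> complex_vector.span (basis_vectors d e) \<Longrightarrow> S x = T x"
  using ext by (simp add: bounded_extension_def)

lemma symbol_norm_le_onorm: "symbol_norm d e T l \<le> onorm S"
  unfolding symbol_norm_def
proof (rule matrix_opnorm_least)
  fix v assume v: "cvec_norm (d l) v \<le> 1"
  have "cvec_norm (d l) (\<lambda>m. \<Sum>k=1..d l. symbol e T l m k * v k) = norm (S (block_vector d e l v))"
    by (simp add: extension_eq block_vector_in_span operator_block norm_block)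
  also have "\<dots> \<le> onorm S * norm (block_vector d e l v)"
    by (rule onorm[OF bounded_linear_extension])
  also have "\<dots> \<le> onorm S"
    using v by (simp add: norm_block mult_left_le onorm_pos_le[OF bounded_linear_extension])
  finally show "cvec_norm (d l) (\<lambda>m. \<Sum>k=1..d l. symbol e T l m k * v k) \<le> onorm S" .
qed

lemma bdd_above_symbol_norm: "bdd_above (range (symbol_norm d e T))"
  using symbol_norm_le_onorm by (intro bdd_aboveI2)

lemma onorm_eq_SUP_symbol_norm: "onorm S = (SUP l. symbol_norm d e T l)"
proof (rule antisym)
  have "norm (S x) \<le> (SUP l. symbol_norm d e T l) * norm x" for x
  proof (rule bound_on_dense_set[OF _ dense_span_basis])
    show "continuous_on UNIV S"
      by (rule linear_continuous_on[OF bounded_linear_extension])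
    show "norm (S x) \<le> (SUP l. symbol_norm d e T l) * norm x"
      if "x \<in> complex_vector.span (basis_vectors d e)" for x
      using that norm_operator_le[OF cSUP_upper[OF _ bdd_above_symbol_norm]]
      by (simp add: extension_eq)
  qed
  then show "onorm S \<le> (SUP l. symbol_norm d e T l)"
    using order_trans[OF symbol_norm_nonneg cSUP_upper[OF UNIV_I bdd_above_symbol_norm]]
    by (intro onorm_bound)
  show "(SUP l. symbol_norm d e T l) \<le> onorm S"
    by (intro cSUP_least symbol_norm_le_onorm) simp
qed

end

lemma bounded_extension_from_symbol:
  assumes "bdd_above (range (symbol_norm d e T))"
  shows "\<exists>S. bounded_extension (complex_vector.span (basis_vectors d e)) T S"
  using lin complex_vector.subspace_span dense_span_basis
    norm_operator_le[OF cSUP_upper[OF UNIV_I assms]]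
  by (rule bounded_extension_of_dense)

end

end


section \<open>Boundedness of Fourier multipliers\<close>

theorem theorem2p3:
  fixes Hinf :: "'a::complex_hilbert set"
    and d :: "nat \<Rightarrow> nat"
    and e :: "nat \<Rightarrow> nat \<Rightarrow> 'a"
    and T :: "'a \<Rightarrow> 'a"
  assumes "complex_vector.subspace Hinf" and "closure Hinf = UNIV"
    and "\<forall>j. d j \<ge> 1"
    and "orthonormal_basis d e"
    and "basis_vectors d e \<subseteq> Hinf"
    and "clinear_on Hinf T"
    and "invariant_operator d e T"
  shows
    "(basis_vectors d e \<subseteq> adjoint_domain Hinf T \<longrightarrow>
        ((\<exists>S. bounded_extension Hinf T S) \<longleftrightarrow> bdd_above (range (symbol_norm d e T)))) \<and>
     (\<forall>S. bounded_extension Hinf T S \<longrightarrow>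
        bdd_above (range (symbol_norm d e T)) \<and> onorm S = (SUP l. symbol_norm d e T l)) \<and>
     ((\<exists>S. bounded_extension (complex_vector.span (basis_vectors d e)) T S) \<longleftrightarrow>
        bdd_above (range (symbol_norm d e T))) \<and>
     (\<forall>S. bounded_extension (complex_vector.span (basis_vectors d e)) T S \<longrightarrow>
        onorm S = (SUP l. symbol_norm d e T l))"
proof -
  let ?V = "complex_vector.span (basis_vectors d e)"
  have V: "?V \<subseteq> Hinf"
    using assms(1,5) by (intro complex_vector.span_minimal)
  then have lin: "clinear_on ?V T"
    using assms(6) unfolding clinear_on_def by blast
  have restrict: "bounded_extension ?V T S" if "bounded_extension Hinf T S" for S
    using that V by (auto simp: bounded_extension_def)
  note bdd = bdd_above_symbol_norm[OF assms(4) lin assms(7)]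
  note onorm = onorm_eq_SUP_symbol_norm[OF assms(4) lin assms(7)]
  note exists = bounded_extension_from_symbol[OF assms(4) lin assms(7)]
  note agrees = extension_agrees_on_domain[OF _ dense_span_basis[OF assms(4)] V]
  show ?thesis
  proof (intro conjI impI allI iffI)
    assume "basis_vectors d e \<subseteq> adjoint_domain Hinf T" and "bdd_above (range (symbol_norm d e T))"
    then show "\<exists>S. bounded_extension Hinf T S"
      using exists agrees by metis
  next
    assume "\<exists>S. bounded_extension Hinf T S"
    then show "bdd_above (range (symbol_norm d e T))"
      using restrict bdd by metis
  qed (use restrict bdd onorm exists in metis)+
qed

end
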